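(* Let $(\bar A,\bar B)$ with $\bar A\in\{0,*\}^{n\times n}$, $\bar B\in\{0,*\}^{n\times m}$ be structurally controllable, and let $\bar F\in\{0,*\}^{n\times(n+m)}$ be a perturbation structure. Then either for almost all $(A,B)\in {\bf CS}(\bar A,\bar B)$, $(A,B)$ is PTC w.r.t. $\bar F$, or for almost all $(A,B)\in {\bf CS}(\bar A,\bar B)$, $(A,B)$ is PSC w.r.t. $\bar F$.
   Context: A structured matrix is a matrix with entries in $\{0,*\}$. For $\bar M\in\{0,*\}^{p\times q}$, ${\bf S}_{\bar M}=\{M\in\mathbb C^{p\times q}: M_{ij}=0 \text{ if } \bar M_{ij}=0\}$; its elements are the realizations of $\bar M$. A pair $(A,B)$, $A\in\mathbb C^{n\times n}$, $B\in\mathbb C^{n\times m}$, is controllable if $[B,AB,\dots,A^{n-1}B]$ has rank $n$. A pair of structured matrices $(\bar A,\bar B)$ is structurally controllable if some $[A,B]\in{\bf S}_{[\bar A,\bar B]}$ is controllable. ${\bf CS}(\bar A,\bar B)$ denotes the set of all controllable complex-valued realizations of $(\bar A,\bar B)$. Given a perturbation structure $\bar F\in\{0,*\}^{n\times(n+m)}$: $(A,B)$ is perturbation-tolerantly controllable (PTC) w.r.t. $\bar F$ if $(A+\Delta A,B+\Delta B)$ is controllable for all $[\Delta A,\Delta B]\in{\bf S}_{\bar F}$ (complex-valued perturbations). $(A,B)$ is perturbation-sensitively controllable (PSC) w.r.t. $\bar F$ if it is controllable but not PTC w.r.t. $\bar F$. "For almost all $(A,B)\in{\bf CS}(\bar A,\bar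 B)$" means: for all except a set of Lebesgue measure zero in the parameter space $\mathbb C^r$, where $r$ is the number of $*$ entries of $[\bar A,\bar B]$ and ${\bf S}_{[\bar A,\bar B]}$ is identified with $\mathbb C^r$ via the values of these entries. *)

theory Defs
  imports
    "HOL-Analysis.Finite_Product_Measure"
    "HOL-Analysis.Lebesgue_Measure"
    "Jordan_Normal_Form.DL_Rank"
begin

datatype entry = Zero | Star

definition append_cols :: "'a mat \<Rightarrow> 'a mat \<Rightarrow> 'a mat"  (infixr \<open>@\<^sub>c\<close> 65) where
  "M @\<^sub>c N = Matrix.mat (dim_row M) (dim_col M + dim_col N)
     (\<lambda>(i, j). if j < dim_col M then M $$ (i, j) else N $$ (i, j - dim_col M))"

definition realizations :: "entry mat \<Rightarrow> complex mat set" where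
  "realizations S = {M \<in> carrier_mat (dim_row S) (dim_col S).
     \<forall>i < dim_row S. \<forall>j < dim_col S. S $$ (i, j) = Zero \<longrightarrow> M $$ (i, j) = 0}"

text \<open>The matrix $[B, AB, \dots, A^{n-1}B]$, where $A$ is $n \times n$ and $B$ is $n \times m$:
  column \<open>k * m + l\<close> (with \<open>l < m\<close>) is column \<open>l\<close> of $A^k B$.\<close>

definition controllability_mat :: "complex mat \<Rightarrow> complex mat \<Rightarrow> complex mat" where
  "controllability_mat A B =
     (let n = dim_row A; m = dim_col B
      in Matrix.mat n (n * m) (\<lambda>(i, j). (A ^\<^sub>m (j div m) * B) $$ (i, j mod m)))"

definition controllable :: "complex mat \<Rightarrow> complex mat \<Rightarrow> bool" where
  "controllable A B \<longleftrightarrow> vec_space.rank (dim_row A) (controllability_mat A B) = dim_row A"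

definition CS :: "entry mat \<Rightarrow> entry mat \<Rightarrow> (complex mat \<times> complex mat) set" where
  "CS SA SB = {(A, B).
     A \<in> carrier_mat (dim_row SA) (dim_col SA) \<and> B \<in> carrier_mat (dim_row SB) (dim_col SB) \<and>
     A @\<^sub>c B \<in> realizations (SA @\<^sub>c SB) \<and> controllable A B}"

definition structurally_controllable :: "entry mat \<Rightarrow> entry mat \<Rightarrow> bool" where
  "structurally_controllable SA SB \<longleftrightarrow>
     (\<exists>A B. A \<in> carrier_mat (dim_row SA) (dim_col SA) \<and>
        B \<in> carrier_mat (dim_row SB) (dim_col SB) \<and>
        A @\<^sub>c B \<in> realizations (SA @\<^sub>c SB) \<and> controllable A B)"

definition PTC :: "entry mat \<Rightarrow> complex mat \<Rightarrow> complex mat \<Rightarrow> bool" where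
  "PTC SF A B \<longleftrightarrow>
     (\<forall>DA DB. DA \<in> carrier_mat (dim_row A) (dim_col A) \<longrightarrow>
        DB \<in> carrier_mat (dim_row B) (dim_col B) \<longrightarrow>
        DA @\<^sub>c DB \<in> realizations SF \<longrightarrow> controllable (A + DA) (B + DB))"

definition PSC :: "entry mat \<Rightarrow> complex mat \<Rightarrow> complex mat \<Rightarrow> bool" where
  "PSC SF A B \<longleftrightarrow> controllable A B \<and> \<not> PTC SF A B"

text \<open>The parameter space $\mathbb{C}^r$ has one coordinate for each of the $r$ positions of
  \<open>Star\<close> entries. Its measure is the product of the Lebesgue-Borel measures of the factors; since
  \<open>AE\<close> only asks that the exceptional set be contained in a measurable null set, it has the same
  meaning for this measure as for its completion, Lebesgue measure.\<close>

definition star_positions :: "entry mat \<Rightarrow> (nat \<times> nat) set" where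
  "star_positions S = {(i, j). i < dim_row S \<and> j < dim_col S \<and> S $$ (i, j) = Star}"

definition parameter_measure :: "entry mat \<Rightarrow> (nat \<times> nat \<Rightarrow> complex) measure" where
  "parameter_measure S = Pi\<^sub>M (star_positions S) (\<lambda>_. lborel)"

definition parameters :: "entry mat \<Rightarrow> complex mat \<Rightarrow> (nat \<times> nat \<Rightarrow> complex)" where
  "parameters S M = restrict (\<lambda>p. M $$ p) (star_positions S)"

lemma finite_star_positions: "finite (star_positions S)"
  by (rule finite_subset[of _ "{..<dim_row S} \<times> {..<dim_col S}"])
     (auto simp: star_positions_def)

lemma bij_betw_parameters:
  "bij_betw (parameters S) (realizations S) (space (parameter_measure S))"
proof (rule bij_betwI[where g = "\<lambda>t. Matrix.mat (dim_row S) (dim_col S)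
         (\<lambda>p. if p \<in> star_positions S then t p else 0)"])
  show "parameters S \<in> realizations S \<rightarrow> space (parameter_measure S)"
    by (auto simp: parameters_def parameter_measure_def space_PiM)
  show "(\<lambda>t. Matrix.mat (dim_row S) (dim_col S) (\<lambda>p. if p \<in> star_positions S then t p else 0))
          \<in> space (parameter_measure S) \<rightarrow> realizations S"
    by (auto simp: realizations_def star_positions_def)
next
  fix M assume M: "M \<in> realizations S"
  have not_Star: "e \<noteq> Star \<longleftrightarrow> e = Zero" for e by (cases e) auto
  show "Matrix.mat (dim_row S) (dim_col S)
      (\<lambda>p. if p \<in> star_positions S then parameters S M p else 0) = M"
    by (intro eq_matI)
       (use M in \<open>auto simp: realizations_def parameters_def star_positions_def not_Star\<close>)
next
  fix t assume "t \<in> space (parameter_measure S)"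
  then show "parameters S (Matrix.mat (dim_row S) (dim_col S)
      (\<lambda>p. if p \<in> star_positions S then t p else 0)) = t"
    by (auto simp: parameters_def parameter_measure_def space_PiM star_positions_def
        PiE_def extensional_def fun_eq_iff)
qed

definition for_almost_all_CS ::
  "entry mat \<Rightarrow> entry mat \<Rightarrow> (complex mat \<Rightarrow> complex mat \<Rightarrow> bool) \<Rightarrow> bool" where
  "for_almost_all_CS SA SB P \<longleftrightarrow>
     (AE t in parameter_measure (SA @\<^sub>c SB).
        \<forall>(A, B) \<in> CS SA SB. parameters (SA @\<^sub>c SB) (A @\<^sub>c B) = t \<longrightarrow> P A B)"

end

theory Submission
  imports
    Defs
    "HOL-Analysis.Continuum_Not_Denumerable"
    "HOL-Analysis.Equivalence_Lebesgue_Henstock_Integration"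
    "HOL-Computational_Algebra.Fundamental_Theorem_Algebra"
begin

text \<open>
  The existence of a perturbation that destroys controllability is a statement about the parameters
  of \<open>(A, B)\<close> that only involves the field operations, with no constants other than \<open>0\<close> and \<open>1\<close>.
  Such a statement cannot distinguish two points whose coordinates are algebraically independent over
  the rational numbers: an isomorphism of the fields generated by the coordinates takes one point to
  the other. Almost all points are of this kind, whence the dichotomy.

  In detail, let \<open>t\<close> and \<open>t'\<close> be generic, that is, have algebraically independent coordinates. Sending
  \<open>t i\<close> to \<open>t' i\<close> defines an isomorphism \<open>\<sigma>\<close> between countable subfields of the complex numbers
  (\<open>generic_points_conjugate\<close>). If the realization at \<open>t\<close> is not PTC, there are a perturbation and a
  nonzero row vector that annihilates the controllability matrix of the perturbed pair. Their finitely
  many entries need not lie in the domain of \<open>\<sigma>\<close>, but \<open>\<sigma>\<close> extends to any one further complex number: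
  to an algebraic one because the complex numbers are algebraically closed, and to a transcendental
  one because they are uncountable (\<open>field_embedding_extends_to_finite\<close>). Applying the extension to the
  perturbation and to the vector shows that the realization at \<open>t'\<close> is not PTC either
  (\<open>generic_not_PTC_invariant\<close>). So PTC holds at all generic controllable realizations or at none of
  them, and in the latter case all of these are PSC. Since non-generic points form a null set
  (\<open>AE_generic\<close>), one of the two alternatives holds almost everywhere.

  The alternatives exclude each other because no realization is both PTC and PSC, while the
  controllable realizations are not negligible: some maximal minor of the controllability matrix is
  nonzero somewhere, hence on a nonempty open set of parameters (\<open>controllable_realizations_not_null\<close>).
\<close>

section \<open>Subfields of the complex numbers\<close>

definition complex_subfield :: "complex set \<Rightarrow> bool" where
  "complex_subfield K \<longleftrightarrow> 1 \<in> K \<and>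
     (\<forall>x\<in>K. - x \<in> K \<and> inverse x \<in> K \<and> (\<forall>y\<in>K. x + y \<in> K \<and> x * y \<in> K))"

lemma
  assumes "complex_subfield K"
  shows subfield_one: "1 \<in> K"
    and subfield_zero: "0 \<in> K"
    and subfield_uminus: "x \<in> K \<Longrightarrow> - x \<in> K"
    and subfield_inverse: "x \<in> K \<Longrightarrow> inverse x \<in> K"
    and subfield_add: "x \<in> K \<Longrightarrow> y \<in> K \<Longrightarrow> x + y \<in> K"
    and subfield_mult: "x \<in> K \<Longrightarrow> y \<in> K \<Longrightarrow> x * y \<in> K"
    and subfield_diff: "x \<in> K \<Longrightarrow> y \<in> K \<Longrightarrow> x - y \<in> K"
    and subfield_divide: "x \<in> K \<Longrightarrow> y \<in> K \<Longrightarrow> x / y \<in> K"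
proof -
  show *: "1 \<in> K" "x \<in> K \<Longrightarrow> - x \<in> K" "x \<in> K \<Longrightarrow> inverse x \<in> K"
    "x \<in> K \<Longrightarrow> y \<in> K \<Longrightarrow> x + y \<in> K" "x \<in> K \<Longrightarrow> y \<in> K \<Longrightarrow> x * y \<in> K" for x y
    using assms by (auto simp: complex_subfield_def)
  show "0 \<in> K" using *(4)[OF *(1) *(2)[OF *(1)]] by simp
  show "x \<in> K \<Longrightarrow> y \<in> K \<Longrightarrow> x - y \<in> K" using *(4)[OF _ *(2), of x y] by simp
  show "x \<in> K \<Longrightarrow> y \<in> K \<Longrightarrow> x / y \<in> K" using *(5)[OF _ *(3), of x y] by (simp add: divide_inverse)
qed

lemma subfield_sum: "complex_subfield K \<Longrightarrow> (\<And>i. i \<in> I \<Longrightarrow> f i \<in> K) \<Longrightarrow> sum f I \<in> K"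
  by (induction I rule: infinite_finite_induct) (auto simp: subfield_zero subfield_add)

definition poly_over :: "complex set \<Rightarrow> complex poly \<Rightarrow> bool" where
  "poly_over K p \<longleftrightarrow> (\<forall>i. coeff p i \<in> K)"

context
  fixes K assumes K: "complex_subfield K"
begin

lemma poly_over_0: "poly_over K 0" and poly_over_1: "poly_over K 1"
  and poly_over_pCons: "a \<in> K \<Longrightarrow> poly_over K p \<Longrightarrow> poly_over K (pCons a p)"
  and poly_over_monom: "a \<in> K \<Longrightarrow> poly_over K (monom a i)"
  and poly_over_uminus: "poly_over K p \<Longrightarrow> poly_over K (- p)"
  and poly_over_add: "poly_over K p \<Longrightarrow> poly_over K q \<Longrightarrow> poly_over K (p + q)"
  and poly_over_diff: "poly_over K p \<Longrightarrow> poly_over K q \<Longrightarrow> poly_over K (p - q)"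
  and poly_over_mult: "poly_over K p \<Longrightarrow> poly_over K q \<Longrightarrow> poly_over K (p * q)"
  using K
  by (auto simp: poly_over_def subfield_zero subfield_one subfield_add subfield_mult subfield_diff
      subfield_uminus coeff_pCons coeff_mult coeff_1 intro!: subfield_sum split: nat.split)

text \<open>The quotient and remainder of complex polynomial division have coefficients in the field
  generated by the coefficients of the operands, because the division algorithm only uses field
  operations. The measure in the induction ranks the zero polynomial below the nonzero constants,
  so that dividing by a constant terminates too.\<close>

lemma poly_over_division:
  assumes p: "poly_over K p" and f: "poly_over K f" "f \<noteq> 0"
  shows "\<exists>u r. poly_over K u \<and> poly_over K r \<and> p = f * u + r \<and> (r = 0 \<or> degree r < degree f)"
  using p
proof (induction "if p = 0 then 0 else Suc (degree p)" arbitrary: p rule: less_induct)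
  case less
  show ?case
  proof (cases "p = 0 \<or> degree p < degree f")
    case True
    then show ?thesis using less.prems poly_over_0 by (intro exI[of _ 0] exI[of _ p]) auto
  next
    case False
    define h where "h = monom (lead_coeff p / lead_coeff f) (degree p - degree f)"
    have h: "poly_over K h"
      unfolding h_def using K less.prems f(1)
      by (intro poly_over_monom subfield_divide) (auto simp: poly_over_def)
    let ?p = "p - f * h"
    have deg: "degree (f * h) = degree p" "coeff (f * h) (degree p) = lead_coeff p"
    proof -
      have "h \<noteq> 0" using False f by (simp add: h_def)
      then show d: "degree (f * h) = degree p"
        using False f by (simp add: degree_mult_eq h_def degree_monom_eq)
      show "coeff (f * h) (degree p) = lead_coeff p"
        using lead_coeff_mult[of f h] False f unfolding d
        by (simp add: h_def degree_monom_eq)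
    qed
    have le: "degree ?p \<le> degree p" using deg(1) by (intro degree_diff_le) auto
    have top: "coeff ?p (degree p) = 0" using deg by simp
    have "?p = 0 \<or> degree ?p < degree p"
      using le top by (metis leading_coeff_0_iff le_neq_implies_less)
    then have dec: "(if ?p = 0 then 0 else Suc (degree ?p)) < (if p = 0 then 0 else Suc (degree p))"
      using False by auto
    have over: "poly_over K ?p"
      by (rule poly_over_diff[OF less.prems poly_over_mult[OF f(1) h]])
    from less.hyps[OF dec over] obtain u r where
      ur: "poly_over K u" "poly_over K r" "?p = f * u + r" "r = 0 \<or> degree r < degree f"
      by blast
    have "p = f * (u + h) + r" using ur(3) by (simp add: algebra_simps)
    then show ?thesis using ur(2,4) poly_over_add[OF ur(1) h] by blast
  qed
qed

lemma countable_poly_over: "countable K \<Longrightarrow> countable (Collect (poly_over K))"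
proof -
  assume "countable K"
  then have "countable (Poly ` lists K)" by auto
  moreover have "p \<in> Poly ` lists K" if "poly_over K p" for p
  proof -
    have "set (coeffs p) \<subseteq> K" using that by (auto simp: coeffs_def poly_over_def)
    then show ?thesis 
      by (intro image_eqI[of _ _ "coeffs p"]) auto
  qed
  ultimately show ?thesis by (auto intro: countable_subset[of _ "Poly ` lists K"])
qed

end

definition algebraic_over :: "complex set \<Rightarrow> complex \<Rightarrow> bool" where
  "algebraic_over K y \<longleftrightarrow> (\<exists>p. poly_over K p \<and> p \<noteq> 0 \<and> poly p y = 0)"

lemma algebraic_over_mono: "K \<subseteq> L \<Longrightarrow> algebraic_over K y \<Longrightarrow> algebraic_over L y"
  by (auto simp: algebraic_over_def poly_over_def)

lemma countable_algebraic_over: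
  assumes "complex_subfield K" "countable K"
  shows "countable {y. algebraic_over K y}"
proof -
  have "countable ({p. poly_over K p} - {0})"
    using countable_poly_over[OF assms] by (rule countable_subset[OF Diff_subset])
  moreover have "countable {y. poly p y = 0}" if "p \<in> {p. poly_over K p} - {0}" for p
    using that by (intro countable_finite poly_roots_finite) auto
  ultimately have "countable (\<Union>p\<in>{p. poly_over K p} - {0}. {y. poly p y = 0})"
    by (rule countable_UN)
  also have "(\<Union>p\<in>{p. poly_over K p} - {0}. {y. poly p y = 0}) = {y. algebraic_over K y}"
    by (auto simp: algebraic_over_def)
  finally show ?thesis .
qed

corollary exists_transcendental_over:
  assumes "complex_subfield K" "countable K"
  shows "\<exists>y. \<not> algebraic_over K y"
  using countable_algebraic_over[OF assms] uncountable_UNIV_complex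
  by (metis UNIV_eq_I mem_Collect_eq)

text \<open>The field \<open>K(y)\<close>. A fraction whose denominator vanishes at \<open>y\<close> has value \<open>0\<close>, which
  belongs to \<open>K(y)\<close> anyway, so it need not be excluded.\<close>

definition adjoin :: "complex set \<Rightarrow> complex \<Rightarrow> complex set" where
  "adjoin K y = {poly p y / poly q y | p q. poly_over K p \<and> poly_over K q}"

lemma countable_adjoin:
  assumes "complex_subfield K" "countable K"
  shows "countable (adjoin K y)"
proof -
  have "adjoin K y =
      (\<lambda>(p, q). poly p y / poly q y) ` (Collect (poly_over K) \<times> Collect (poly_over K))"
    by (auto simp: adjoin_def)
  then show ?thesis using countable_poly_over[OF assms] by auto
qed

lemma adjoin_subset:
  assumes M: "complex_subfield M" and "K \<subseteq> M" "y \<in> M"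
  shows "adjoin K y \<subseteq> M"
proof -
  have pow: "y ^ i \<in> M" for i
    by (induction i) (use assms in \<open>auto intro: subfield_one subfield_mult\<close>)
  have "poly p y \<in> M" if "poly_over K p" for p
    unfolding poly_altdef using that assms(2) pow M
    by (auto simp: poly_over_def intro!: subfield_sum subfield_mult)
  then show ?thesis using M by (auto simp: adjoin_def intro: subfield_divide)
qed

section \<open>Extending isomorphisms between subfields\<close>

text \<open>An isomorphism from a subfield \<open>K\<close> of the complex numbers onto another one; injectivity is
  automatic for homomorphisms of fields (\<open>eq_0_iff\<close>). Values of \<open>\<sigma>\<close> outside \<open>K\<close> are arbitrary, so
  that an extension to a larger field is simply another function that agrees on \<open>K\<close>.\<close>

locale field_embedding =
  fixes K :: "complex set" and \<sigma> :: "complex \<Rightarrow> complex"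
  assumes subfield: "complex_subfield K"
    and one: "\<sigma> 1 = 1"
    and add: "x \<in> K \<Longrightarrow> y \<in> K \<Longrightarrow> \<sigma> (x + y) = \<sigma> x + \<sigma> y"
    and mult: "x \<in> K \<Longrightarrow> y \<in> K \<Longrightarrow> \<sigma> (x * y) = \<sigma> x * \<sigma> y"
begin

lemmas K_closed =
  subfield_zero[OF subfield] subfield_one[OF subfield] subfield_uminus[OF subfield]
  subfield_inverse[OF subfield] subfield_add[OF subfield] subfield_mult[OF subfield]
  subfield_diff[OF subfield] subfield_divide[OF subfield] subfield_sum[OF subfield]

lemma zero: "\<sigma> 0 = 0"
  using add[of 0 0] K_closed by simp

lemma uminus: "x \<in> K \<Longrightarrow> \<sigma> (- x) = - \<sigma> x"
  using add[of x "- x"] K_closed zero by (simp add: add_eq_0_iff)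

lemma inverse: "x \<in> K \<Longrightarrow> \<sigma> (inverse x) = inverse (\<sigma> x)"
proof (cases "x = 0")
  case False
  moreover assume "x \<in> K"
  ultimately have "\<sigma> x * \<sigma> (inverse x) = 1"
    using mult[of x "inverse x"] K_closed one by simp
  then show ?thesis by (metis inverse_unique)
qed (simp add: zero)

lemma eq_0_iff: "x \<in> K \<Longrightarrow> \<sigma> x = 0 \<longleftrightarrow> x = 0"
  using inverse[of x] mult[of x "Fields.inverse x"] K_closed zero one by (cases "x = 0") auto

lemma sum: "(\<And>i. i \<in> I \<Longrightarrow> f i \<in> K) \<Longrightarrow> \<sigma> (sum f I) = (\<Sum>i\<in>I. \<sigma> (f i))"
  by (induction I rule: infinite_finite_induct) (auto simp: zero add K_closed)

lemma subfield_image: "complex_subfield (\<sigma> ` K)"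
  unfolding complex_subfield_def
  by (auto simp flip: uminus inverse add mult intro!: imageI K_closed) (metis K_closed(2) image_eqI one)

abbreviation \<sigma>p :: "complex poly \<Rightarrow> complex poly" where
  "\<sigma>p \<equiv> map_poly \<sigma>"

lemma coeff_map: "coeff (\<sigma>p p) i = \<sigma> (coeff p i)"
  by (simp add: coeff_map_poly zero)

lemma map_over: "poly_over K p \<Longrightarrow> poly_over (\<sigma> ` K) (\<sigma>p p)"
  by (auto simp: poly_over_def coeff_map)

lemma map_eq_0_iff: "poly_over K p \<Longrightarrow> \<sigma>p p = 0 \<longleftrightarrow> p = 0"
  by (auto simp: poly_eq_iff coeff_map poly_over_def eq_0_iff)

lemma degree_map: "poly_over K p \<Longrightarrow> degree (\<sigma>p p) = degree p"
  by (cases "p = 0") (auto intro!: map_poly_degree_eq simp: poly_over_def eq_0_iff)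

lemma map_add: "poly_over K p \<Longrightarrow> poly_over K q \<Longrightarrow> \<sigma>p (p + q) = \<sigma>p p + \<sigma>p q"
  by (auto simp: poly_eq_iff coeff_map poly_over_def add)

lemma map_uminus: "poly_over K p \<Longrightarrow> \<sigma>p (- p) = - \<sigma>p p"
  by (auto simp: poly_eq_iff coeff_map poly_over_def uminus)

lemma map_diff: "poly_over K p \<Longrightarrow> poly_over K q \<Longrightarrow> \<sigma>p (p - q) = \<sigma>p p - \<sigma>p q"
  using map_add[of p "- q"] by (simp add: map_uminus poly_over_uminus[OF subfield])

lemma map_mult: "poly_over K p \<Longrightarrow> poly_over K q \<Longrightarrow> \<sigma>p (p * q) = \<sigma>p p * \<sigma>p q"
  by (auto simp: poly_eq_iff coeff_map poly_over_def coeff_mult sum mult K_closed)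

text \<open>This says exactly that \<open>y \<mapsto> z\<close> extends \<open>\<sigma>\<close> to a well-defined and injective map on the
  polynomial expressions in \<open>y\<close>. It covers the algebraic and the transcendental case at once.\<close>

definition conjugate :: "complex \<Rightarrow> complex \<Rightarrow> bool" where
  "conjugate y z \<longleftrightarrow> (\<forall>p. poly_over K p \<longrightarrow> (poly (\<sigma>p p) z = 0 \<longleftrightarrow> poly p y = 0))"

lemma conjugate_transcendental:
  assumes "\<not> algebraic_over K y" "\<not> algebraic_over (\<sigma> ` K) z"
  shows "conjugate y z"
  unfolding conjugate_def
proof (intro allI impI)
  fix p assume p: "poly_over K p"
  show "poly (\<sigma>p p) z = 0 \<longleftrightarrow> poly p y = 0"
  proof (cases "p = 0")
    case False
    then show ?thesis
      using assms p map_over[OF p] map_eq_0_iff[OF p] unfolding algebraic_over_def by blast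
  qed simp
qed

text \<open>A root \<open>z\<close> of the image of the minimal polynomial \<open>f\<close> of \<open>y\<close> is a conjugate. Polynomials that
  vanish at \<open>y\<close> are multiples of \<open>f\<close>, so their images vanish at \<open>z\<close>. If \<open>g\<close> does not vanish at
  \<open>y\<close>, then \<open>g\<close> is invertible modulo \<open>f\<close>, and this relation is preserved by \<open>\<sigma>\<close>, so the image of \<open>g\<close>
  does not vanish at \<open>z\<close>.\<close>

lemma conjugate_algebraic:
  assumes "algebraic_over K y"
  shows "\<exists>z. conjugate y z"
proof -
  obtain f where f: "poly_over K f" "f \<noteq> 0" "poly f y = 0"
    and min: "\<And>g. poly_over K g \<Longrightarrow> g \<noteq> 0 \<Longrightarrow> poly g y = 0 \<Longrightarrow> degree f \<le> degree g"
    using ex_has_least_nat[of "\<lambda>f. poly_over K f \<and> f \<noteq> 0 \<and> poly f y = 0" _ degree] assms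
    unfolding algebraic_over_def by metis
  have dvd: "\<exists>u. poly_over K u \<and> g = f * u" if g: "poly_over K g" "poly g y = 0" for g
  proof -
    obtain u r where ur: "poly_over K u" "poly_over K r" "g = f * u + r" "r = 0 \<or> degree r < degree f"
      using poly_over_division[OF subfield g(1) f(1,2)] by blast
    then have "poly r y = 0" using g(2) f(3) by simp
    then have "\<not> degree r < degree f" if "r \<noteq> 0" using min[OF ur(2) that] by simp
    then have "r = 0" using ur(4) by blast
    with ur show ?thesis by auto
  qed
  \<comment> \<open>Euclid: divide \<open>f\<close> by \<open>g\<close>; the remainder has smaller degree and still does not vanish at \<open>y\<close>.\<close>
  have bezout_small: "\<exists>u. poly_over K u \<and> poly (g * u) y = 1"
    if "poly_over K g" "poly g y \<noteq> 0" "degree g < degree f" for g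
    using that
  proof (induction "degree g" arbitrary: g rule: less_induct)
    case less
    have g0: "g \<noteq> 0" using less.prems by auto
    obtain u r where ur: "poly_over K u" "poly_over K r" "f = g * u + r" "r = 0 \<or> degree r < degree g"
      using poly_over_division[OF subfield f(1) less.prems(1) g0] by blast
    show ?case
    proof (cases "degree g = 0")
      case True
      then obtain c where c: "g = [:c:]" by (metis degree_eq_zeroE)
      moreover have "coeff g 0 \<in> K" using less.prems(1) by (simp add: poly_over_def)
      ultimately have "c \<in> K" "c \<noteq> 0" using g0 by auto
      then show ?thesis
        by (intro exI[of _ "[:Fields.inverse c:]"])
          (auto simp: c intro!: poly_over_pCons[OF subfield] poly_over_0[OF subfield] K_closed)
    next
      case False
      have "r \<noteq> 0"
      proof
        assume "r = 0"
        then have fgu: "f = g * u" using ur by simp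
        then have "poly u y = 0" "u \<noteq> 0" using f(2,3) less.prems(2) by auto
        then have "degree f \<le> degree u" using min ur(1) by blast
        then show False using fgu False g0 \<open>u \<noteq> 0\<close> by (simp add: degree_mult_eq)
      qed
      then have r: "degree r < degree g" "degree r < degree f" using ur(4) less.prems(3) by auto
      then have "poly r y \<noteq> 0" using min[OF ur(2) \<open>r \<noteq> 0\<close>] by auto
      from less.hyps[OF r(1) ur(2) this r(2)] obtain w where
        w: "poly_over K w" "poly (r * w) y = 1" by blast
      have "poly r y = - poly g y * poly u y" using ur(3) f(3)
        by (metis add.commute add_eq_0_iff mult_minus_left poly_add poly_mult)
      then have "poly (g * - (u * w)) y = 1" using w(2) by (simp add: mult.assoc)
      then show ?thesis
        using ur(1) w(1) poly_over_mult[OF subfield] poly_over_uminus[OF subfield] by blast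
    qed
  qed
  \<comment> \<open>Reduction modulo \<open>f\<close> does not change the value at \<open>y\<close>.\<close>
  have bezout: "\<exists>u. poly_over K u \<and> poly (g * u) y = 1"
    if g: "poly_over K g" "poly g y \<noteq> 0" for g
  proof -
    obtain u r where ur: "poly_over K u" "poly_over K r" "g = f * u + r" "r = 0 \<or> degree r < degree f"
      using poly_over_division[OF subfield g(1) f(1,2)] by blast
    then have "poly r y = poly g y" using f(3) by simp
    moreover from this have "degree r < degree f" using ur(4) g(2) by auto
    ultimately show ?thesis using bezout_small[OF ur(2)] g(2) by (metis poly_mult)
  qed
  have "degree (\<sigma>p f) \<noteq> 0"
    unfolding degree_map[OF f(1)] using f(2,3) by (metis degree_eq_zeroE mult_zero_right add.right_neutral pCons_0_0 poly_pCons poly_0)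
  then obtain z where z: "poly (\<sigma>p f) z = 0"
    using fundamental_theorem_of_algebra constant_degree by metis
  have vanish: "poly (\<sigma>p g) z = 0" if "poly_over K g" "poly g y = 0" for g
    using dvd[OF that] z by (auto simp: map_mult[OF f(1)])
  have "conjugate y z"
    unfolding conjugate_def
  proof (intro allI impI iffI)
    fix g assume g: "poly_over K g" and gz: "poly (\<sigma>p g) z = 0"
    show "poly g y = 0"
    proof (rule ccontr)
      assume "poly g y \<noteq> 0"
      then obtain u where u: "poly_over K u" "poly (g * u) y = 1" using bezout[OF g] by blast
      have gu: "poly_over K (g * u)" using g u(1) poly_over_mult[OF subfield] by blast
      have "poly (\<sigma>p (g * u - 1)) z = 0"
        using u(2) gu by (intro vanish poly_over_diff poly_over_1 subfield) auto
      moreover have "\<sigma>p 1 = 1"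
        by (auto simp: poly_eq_iff coeff_map coeff_1 zero one)
      ultimately show False
        using gz gu by (simp add: map_diff poly_over_1[OF subfield] map_mult g u(1))
    qed
  qed (use vanish in blast)
  then show ?thesis by blast
qed

text \<open>The last two inclusions bound the new field and its image by \<open>K(y)\<close> and \<open>\<sigma>(K)(z)\<close>; the first
  keeps the domain countable, and both are needed to see which elements stay transcendental.\<close>

lemma extends_to_conjugate:
  assumes "conjugate y z"
  shows "\<exists>L \<tau>. field_embedding L \<tau> \<and> (\<forall>x\<in>K. \<tau> x = \<sigma> x) \<and> \<tau> y = z \<and> K \<subseteq> L \<and> y \<in> L \<and>
    L \<subseteq> adjoin K y \<and> \<tau> ` L \<subseteq> adjoin (\<sigma> ` K) z"
proof -
  define L where "L = {poly p y / poly q y | p q. poly_over K p \<and> poly_over K q \<and> poly q y \<noteq> 0}"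
  note over = poly_over_0[OF subfield] poly_over_1[OF subfield] poly_over_add[OF subfield]
    poly_over_mult[OF subfield] poly_over_pCons[OF subfield] poly_over_uminus[OF subfield]
    poly_over_diff[OF subfield]
  have conj: "poly (\<sigma>p p) z = 0 \<longleftrightarrow> poly p y = 0" if "poly_over K p" for p
    using assms(1) that by (auto simp: conjugate_def)
  have "\<exists>w. \<exists>p q. poly_over K p \<and> poly_over K q \<and> poly q y \<noteq> 0 \<and> x = poly p y / poly q y \<and>
      w = poly (\<sigma>p p) z / poly (\<sigma>p q) z" if "x \<in> L" for x
    using that unfolding L_def by blast
  then obtain \<tau> where \<tau>: "\<And>x. x \<in> L \<Longrightarrow> \<exists>p q. poly_over K p \<and> poly_over K q \<and> poly q y \<noteq> 0 \<and>
      x = poly p y / poly q y \<and> \<tau> x = poly (\<sigma>p p) z / poly (\<sigma>p q) z"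
    by metis
  \<comment> \<open>The value does not depend on the chosen fraction: cross-multiply and apply conjugacy.\<close>
  have \<tau>_eq: "poly p y / poly q y \<in> L"
    "\<tau> (poly p y / poly q y) = poly (\<sigma>p p) z / poly (\<sigma>p q) z"
    if pq: "poly_over K p" "poly_over K q" "poly q y \<noteq> 0" for p q
  proof -
    show L: "poly p y / poly q y \<in> L" unfolding L_def using pq by blast
    obtain r s where rs: "poly_over K r" "poly_over K s" "poly s y \<noteq> 0"
      "poly p y / poly q y = poly r y / poly s y"
      "\<tau> (poly p y / poly q y) = poly (\<sigma>p r) z / poly (\<sigma>p s) z"
      using \<tau>[OF L] by blast
    have "poly (p * s - r * q) y = 0" using rs pq by (simp add: field_simps)
    then have "poly (\<sigma>p (p * s - r * q)) z = 0" using rs pq by (subst conj) (auto intro: over)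
    then have "poly (\<sigma>p p) z * poly (\<sigma>p s) z = poly (\<sigma>p r) z * poly (\<sigma>p q) z"
      using rs pq by (simp add: map_diff map_mult over)
    then show "\<tau> (poly p y / poly q y) = poly (\<sigma>p p) z / poly (\<sigma>p q) z"
      unfolding rs(5) using conj[OF rs(2)] conj[OF pq(2)] pq(3) rs(3) by (simp add: frac_eq_eq)
  qed
  have \<sigma>p_const: "\<sigma>p [:c:] = [:\<sigma> c:]" for c
    by (auto simp: poly_eq_iff coeff_map coeff_pCons zero split: nat.split)
  have K: "x \<in> L" "\<tau> x = \<sigma> x" if "x \<in> K" for x
    using \<tau>_eq[of "[:x:]" 1] that over K_closed \<sigma>p_const[of x] \<sigma>p_const[of 1]
    by (auto simp: one one_pCons)
  have y: "y \<in> L" "\<tau> y = z"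
  proof -
    have "\<sigma>p [:0, 1:] = [:0, 1:]" "\<sigma>p 1 = 1"
      by (auto simp: poly_eq_iff coeff_map coeff_pCons zero one coeff_1 split: nat.split)
    then show "y \<in> L" "\<tau> y = z"
      using \<tau>_eq[of "[:0, 1:]" 1] over K_closed by auto
  qed
  have ops: "a + b \<in> L \<and> a * b \<in> L \<and> \<tau> (a + b) = \<tau> a + \<tau> b \<and> \<tau> (a * b) = \<tau> a * \<tau> b"
    if ab: "a \<in> L" "b \<in> L" for a b
  proof -
    obtain p q r s where pq: "poly_over K p" "poly_over K q" "poly q y \<noteq> 0" "a = poly p y / poly q y"
      and rs: "poly_over K r" "poly_over K s" "poly s y \<noteq> 0" "b = poly r y / poly s y"
      using ab unfolding L_def by blast
    have ab_eq: "a + b = poly (p * s + r * q) y / poly (q * s) y" "a * b = poly (p * r) y / poly (q * s) y"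
      unfolding pq(4) rs(4) using pq(3) rs(3) by (simp_all add: field_simps)
    have nz: "poly (\<sigma>p q) z \<noteq> 0" "poly (\<sigma>p s) z \<noteq> 0" using conj pq rs by auto
    have 1: "poly_over K (p * s + r * q)" "poly_over K (p * r)" "poly_over K (q * s)" "poly (q * s) y \<noteq> 0"
      using pq rs over by auto
    have \<tau>a: "\<tau> a = poly (\<sigma>p p) z / poly (\<sigma>p q) z" and \<tau>b: "\<tau> b = poly (\<sigma>p r) z / poly (\<sigma>p s) z"
      unfolding pq(4) rs(4) by (intro \<tau>_eq pq rs)+
    have "\<tau> (a + b) = poly (\<sigma>p (p * s + r * q)) z / poly (\<sigma>p (q * s)) z"
      "\<tau> (a * b) = poly (\<sigma>p (p * r)) z / poly (\<sigma>p (q * s)) z"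
      unfolding ab_eq by (intro \<tau>_eq 1)+
    then have "\<tau> (a + b) = \<tau> a + \<tau> b" "\<tau> (a * b) = \<tau> a * \<tau> b"
      unfolding \<tau>a \<tau>b using pq(1,2) rs(1,2) nz
      by (simp_all add: map_add map_mult over add_frac_eq)
    moreover have "a + b \<in> L" "a * b \<in> L" unfolding ab_eq by (intro \<tau>_eq 1)+
    ultimately show ?thesis by blast
  qed
  have "- x \<in> L \<and> Fields.inverse x \<in> L" if x: "x \<in> L" for x
  proof -
    obtain p q where pq: "poly_over K p" "poly_over K q" "poly q y \<noteq> 0" "x = poly p y / poly q y"
      using x unfolding L_def by blast
    have "- x \<in> L" using \<tau>_eq(1)[of "- p" q] pq over by auto
    moreover have "Fields.inverse x = poly q y / poly p y" using pq(4) by simp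
    then have "Fields.inverse x \<in> L"
      using \<tau>_eq(1)[of q p] pq(1,2) K(1)[of 0] K_closed(1) by (cases "poly p y = 0") simp_all
    ultimately show ?thesis by blast
  qed
  then have "field_embedding L \<tau>"
    using ops K K_closed one by unfold_locales (auto simp: complex_subfield_def)
  moreover have "\<tau> ` L \<subseteq> adjoin (\<sigma> ` K) z"
    using \<tau> map_over unfolding adjoin_def by blast
  moreover have "L \<subseteq> adjoin K y" unfolding L_def adjoin_def by blast
  ultimately show ?thesis using K y by blast
qed

text \<open>An algebraic \<open>y\<close> is sent to a conjugate root. A transcendental \<open>y\<close> may be sent to any number that
  is transcendental over \<open>\<sigma>(K)\<close>, and such numbers exist because \<open>\<sigma>(K)\<close> is countable.\<close>

lemma extends_to_element:
  assumes "countable K"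
  shows "\<exists>L \<tau>. field_embedding L \<tau> \<and> countable L \<and> (\<forall>x\<in>K. \<tau> x = \<sigma> x) \<and> K \<subseteq> L \<and> y \<in> L"
proof -
  obtain z where "conjugate y z"
  proof (cases "algebraic_over K y")
    case True
    then show ?thesis using conjugate_algebraic that by blast
  next
    case False
    then show ?thesis
      using exists_transcendental_over[OF subfield_image] assms conjugate_transcendental that by blast
  qed
  from extends_to_conjugate[OF this] show ?thesis
    using countable_adjoin[OF subfield assms, of y] by (meson countable_subset)
qed

end

lemma field_embedding_extends_to_finite:
  assumes "finite X" "field_embedding K \<sigma>" "countable K"
  shows "\<exists>L \<tau>. field_embedding L \<tau> \<and> countable L \<and> (\<forall>x\<in>K. \<tau> x = \<sigma> x) \<and> K \<union> X \<subseteq> L"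
  using assms(1)
proof induction
  case empty
  then show ?case using assms by auto
next
  case (insert y X)
  then obtain L \<tau> where L: "field_embedding L \<tau>" "countable L" "\<forall>x\<in>K. \<tau> x = \<sigma> x" "K \<union> X \<subseteq> L"
    by blast
  from field_embedding.extends_to_element[OF L(1,2), of y] obtain M \<rho> where
    "field_embedding M \<rho>" "countable M" "\<forall>x\<in>L. \<rho> x = \<tau> x" "L \<subseteq> M" "y \<in> M" by blast
  then show ?case using L by (intro exI[of _ M] exI[of _ \<rho>]) auto
qed

section \<open>Generic points\<close>

text \<open>A countable syntax for the elements of the field generated by given numbers. It makes these fields
  countable, and it turns statements about algebraic dependence into countable unions of measurable
  conditions. The inverse of \<open>0\<close> is \<open>0\<close>, so every expression has a value.\<close>

datatype (vars: 'v) field_expr =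
  Var 'v | One | Neg "'v field_expr" | Inv "'v field_expr"
  | Plus "'v field_expr" "'v field_expr" | Times "'v field_expr" "'v field_expr"

instance field_expr :: (countable) countable
  by countable_datatype

primrec field_value :: "'v field_expr \<Rightarrow> ('v \<Rightarrow> complex) \<Rightarrow> complex" where
  "field_value (Var v) t = t v"
| "field_value One t = 1"
| "field_value (Neg a) t = - field_value a t"
| "field_value (Inv a) t = inverse (field_value a t)"
| "field_value (Plus a b) t = field_value a t + field_value b t"
| "field_value (Times a b) t = field_value a t * field_value b t"

lemma field_value_cong:
  "(\<And>v. v \<in> vars e \<Longrightarrow> t v = t' v) \<Longrightarrow> field_value e t = field_value e t'"
  by (induction e) auto

definition generated :: "'v set \<Rightarrow> ('v \<Rightarrow> complex) \<Rightarrow> complex set" where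
  "generated J t = (\<lambda>e. field_value e t) ` {e. vars e \<subseteq> J}"

lemma generated_subfield: "complex_subfield (generated J t)"
proof -
  have "field_value e t \<in> generated J t" if "vars e \<subseteq> J" for e
    using that by (auto simp: generated_def)
  from this[of One] this[of "Neg _"] this[of "Inv _"] this[of "Plus _ _"] this[of "Times _ _"]
  show ?thesis by (auto simp: complex_subfield_def generated_def)
qed

lemma generated_var: "j \<in> J \<Longrightarrow> t j \<in> generated J t"
  unfolding generated_def by (rule image_eqI[of _ _ "Var j"]) auto

lemma generated_mono: "J \<subseteq> J' \<Longrightarrow> generated J t \<subseteq> generated J' t"
  by (auto simp: generated_def)

lemma generated_empty: "generated {} t = generated {} t'" for t t' :: "'v \<Rightarrow> complex"
  unfolding generated_def by (rule image_cong[OF refl]) (auto intro: field_value_cong)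

lemma countable_generated: "countable (generated J (t :: 'v::countable \<Rightarrow> complex))"
  by (simp add: generated_def)

text \<open>Algebraic independence of the coordinates over the rational numbers.\<close>

definition generic :: "'v set \<Rightarrow> ('v \<Rightarrow> complex) \<Rightarrow> bool" where
  "generic I t \<longleftrightarrow> (\<forall>i\<in>I. \<not> algebraic_over (generated (I - {i}) t) (t i))"

text \<open>Two generic points look the same to field theory: adding one coordinate at a time, \<open>t i\<close> is
  transcendental over the field generated by the earlier coordinates, as is \<open>t' i\<close> over its image,
  so sending \<open>t i\<close> to \<open>t' i\<close> extends the isomorphism built so far.\<close>

lemma generic_points_conjugate:
  fixes t t' :: "'v::countable \<Rightarrow> complex"
  assumes "finite I" "generic I t" "generic I t'"
  shows "\<exists>K \<sigma>. field_embedding K \<sigma> \<and> countable K \<and> (\<forall>i\<in>I. t i \<in> K \<and> \<sigma> (t i) = t' i)"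
proof -
  have "\<exists>K \<sigma>. field_embedding K \<sigma> \<and> K \<subseteq> generated J t \<and> \<sigma> ` K \<subseteq> generated J t' \<and>
      (\<forall>i\<in>J. t i \<in> K \<and> \<sigma> (t i) = t' i)" if "finite J" "J \<subseteq> I" for J
    using that
  proof (induction J rule: finite_induct)
    case empty
    have "field_embedding (generated {} t) (\<lambda>x. x)"
      by unfold_locales (auto simp: generated_subfield)
    then show ?case using generated_empty[of t t']
      by (intro exI[of _ "generated {} t"] exI[of _ "\<lambda>x. x"]) auto
  next
    case (insert i J)
    then obtain K \<sigma> where K: "field_embedding K \<sigma>" "K \<subseteq> generated J t" "\<sigma> ` K \<subseteq> generated J t'"
      "\<forall>i\<in>J. t i \<in> K \<and> \<sigma> (t i) = t' i" by auto
    interpret field_embedding K \<sigma> by fact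
    have sub: "J \<subseteq> I - {i}" "i \<in> I" using insert by auto
    have "\<not> algebraic_over K (t i)"
      using assms(2) sub(2) algebraic_over_mono[OF subset_trans[OF K(2) generated_mono[OF sub(1)]]]
      unfolding generic_def by blast
    moreover have "\<not> algebraic_over (\<sigma> ` K) (t' i)"
      using assms(3) sub(2) algebraic_over_mono[OF subset_trans[OF K(3) generated_mono[OF sub(1)]]]
      unfolding generic_def by blast
    ultimately have "conjugate (t i) (t' i)" by (rule conjugate_transcendental)
    from extends_to_conjugate[OF this] obtain L \<tau> where
      L: "field_embedding L \<tau>" "\<forall>x\<in>K. \<tau> x = \<sigma> x" "\<tau> (t i) = t' i" "K \<subseteq> L" "t i \<in> L"
      "L \<subseteq> adjoin K (t i)" "\<tau> ` L \<subseteq> adjoin (\<sigma> ` K) (t' i)" by blast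
    have "adjoin K (t i) \<subseteq> generated (insert i J) t"
      "adjoin (\<sigma> ` K) (t' i) \<subseteq> generated (insert i J) t'"
      using K(2,3) generated_mono[of J "insert i J"]
      by (intro adjoin_subset generated_subfield generated_var; blast)+
    then have "L \<subseteq> generated (insert i J) t" "\<tau> ` L \<subseteq> generated (insert i J) t'"
      using L by blast+
    moreover have "\<forall>j\<in>insert i J. t j \<in> L \<and> \<tau> (t j) = t' j" using L K(4) by auto
    ultimately show ?case using L(1) by blast
  qed
  from this[OF assms(1) order_refl] obtain K \<sigma> where
    K: "field_embedding K \<sigma>" "K \<subseteq> generated I t" "\<forall>i\<in>I. t i \<in> K \<and> \<sigma> (t i) = t' i" by blast
  moreover have "countable K" using K(2) countable_generated by (rule countable_subset)
  ultimately show ?thesis by blast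
qed

lemma field_value_fun:
  "field_value (Var v) = (\<lambda>t. t v)"
  "field_value One = (\<lambda>t. 1)"
  "field_value (Neg a) = (\<lambda>t. - field_value a t)"
  "field_value (Inv a) = (\<lambda>t. inverse (field_value a t))"
  "field_value (Plus a b) = (\<lambda>t. field_value a t + field_value b t)"
  "field_value (Times a b) = (\<lambda>t. field_value a t * field_value b t)"
  by (simp_all add: fun_eq_iff)

lemma measurable_field_value:
  assumes "vars e \<subseteq> I"
  shows "field_value e \<in> borel_measurable (Pi\<^sub>M I (\<lambda>_. lborel :: complex measure))"
  using assms
proof (induction e)
  case (Var v)
  then have "(\<lambda>t. t v) \<in> measurable (Pi\<^sub>M I (\<lambda>_. lborel :: complex measure)) lborel"
    by (intro measurable_component_singleton) auto
  then show ?case by (simp add: measurable_lborel2 field_value_fun)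
qed (auto simp: field_value_fun)

lemma Poly_eq_0_iff_all: "Poly xs = 0 \<longleftrightarrow> (\<forall>x\<in>set xs. x = 0)"
  by (induction xs) auto

text \<open>Non-generic points satisfy, for some \<open>i\<close>, one of countably many polynomial equations for \<open>t i\<close>
  with coefficients that depend on the other coordinates and do not all vanish. Each such equation
  has finitely many solutions \<open>t i\<close> once the other coordinates are fixed, hence by Fubini it cuts
  out a null set.\<close>

lemma AE_generic:
  fixes I :: "'v::countable set"
  assumes I: "finite I"
  shows "AE t in Pi\<^sub>M I (\<lambda>_. lborel :: complex measure). generic I t"
proof -
  let ?M = "\<lambda>I. Pi\<^sub>M I (\<lambda>_. lborel :: complex measure)"
  interpret product_sigma_finite "\<lambda>_::'v. lborel :: complex measure" ..
  have "AE t in ?M I. \<not> algebraic_over (generated (I - {i}) t) (t i)" if i: "i \<in> I" for i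
  proof -
    define P where "P es t = Poly (map (\<lambda>e. field_value e t) es)" for es :: "'v field_expr list" and t
    define N where "N es = {t \<in> space (?M I). P es t \<noteq> 0 \<and> poly (P es t) (t i) = 0}" for es
    define ES where "ES = {es. \<forall>e\<in>set es. vars e \<subseteq> I - {i}}"
    have null: "N es \<in> null_sets (?M I)" if es: "es \<in> ES" for es
    proof (rule null_setsI)
      have val: "field_value e \<in> borel_measurable (?M I)" if "e \<in> set es" for e
        using es that unfolding ES_def by (intro measurable_field_value) auto
      have [measurable]: "(\<lambda>t. t i) \<in> borel_measurable (?M I)"
        using measurable_field_value[of "Var i" I] i by (simp add: field_value_fun)
      have [measurable]: "(\<lambda>t. poly (P es t) (t i)) \<in> borel_measurable (?M I)"
        using val unfolding P_def by (induction es) auto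
      have "{t \<in> space (?M I). P es t \<noteq> 0} = (\<Union>e\<in>set es. {t \<in> space (?M I). field_value e t \<noteq> 0})"
        by (auto simp: P_def Poly_eq_0_iff_all)
      also have "\<dots> \<in> sets (?M I)"
        using val by (intro sets.finite_UN) auto
      finally have [measurable]: "Measurable.pred (?M I) (\<lambda>t. P es t \<noteq> 0)"
        by (simp add: pred_def)
      show sets: "N es \<in> sets (?M I)"
        unfolding N_def by measurable
      have I_eq: "insert i (I - {i}) = I" using i by auto
      have "emeasure (?M I) (N es) = (\<integral>\<^sup>+t. indicator (N es) t \<partial>?M I)"
        using sets by simp
      also have "\<dots> = (\<integral>\<^sup>+x. \<integral>\<^sup>+y. indicator (N es) (x(i := y)) \<partial>lborel \<partial>?M (I - {i}))"
        using product_nn_integral_insert[of "I - {i}" i "indicator (N es)"] I sets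
        unfolding I_eq by simp
      also have "\<dots> = (\<integral>\<^sup>+x. 0 \<partial>?M (I - {i}))"
      proof (intro nn_integral_cong)
        fix x
        have "i \<notin> vars e" if "e \<in> set es" for e using es that unfolding ES_def by blast
        then have P_eq: "P es (x(i := y)) = P es x" for y
          unfolding P_def by (auto intro!: arg_cong[of _ _ Poly] field_value_cong)
        define Z where "Z = (if P es x = 0 then {} else {y. poly (P es x) y = 0})"
        have Z: "finite Z" by (auto simp: Z_def poly_roots_finite)
        have "(\<integral>\<^sup>+y. indicator (N es) (x(i := y)) \<partial>lborel) \<le> (\<integral>\<^sup>+y. indicator Z y \<partial>lborel)"
          by (intro nn_integral_mono) (auto simp: N_def Z_def P_eq indicator_def)
        also have "\<dots> = emeasure lborel Z"
          using finite_imp_closed[OF Z] by (intro nn_integral_indicator) auto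
        also have "\<dots> = 0" using Z by (intro emeasure_lborel_countable countable_finite)
        finally show "(\<integral>\<^sup>+y. indicator (N es) (x(i := y)) \<partial>lborel) = 0" by simp
      qed
      finally show "emeasure (?M I) (N es) = 0" by simp
    qed
    have "(\<Union>es\<in>ES. N es) \<in> null_sets (?M I)"
      using null by (intro null_sets_UN') auto
    moreover have "{t \<in> space (?M I). algebraic_over (generated (I - {i}) t) (t i)} \<subseteq> (\<Union>es\<in>ES. N es)"
    proof safe
      fix t assume t: "t \<in> space (?M I)" "algebraic_over (generated (I - {i}) t) (t i)"
      then obtain p where p: "poly_over (generated (I - {i}) t) p" "p \<noteq> 0" "poly p (t i) = 0"
        by (auto simp: algebraic_over_def)
      have "\<forall>c\<in>set (coeffs p). \<exists>e. vars e \<subseteq> I - {i} \<and> field_value e t = c"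
      proof
        fix c assume "c \<in> set (coeffs p)"
        then have "c \<in> generated (I - {i}) t"
          using p(1) by (auto simp: poly_over_def coeffs_def split: if_splits)
        then show "\<exists>e. vars e \<subseteq> I - {i} \<and> field_value e t = c" by (auto simp: generated_def)
      qed
      then obtain e where e: "\<And>c. c \<in> set (coeffs p) \<Longrightarrow> vars (e c) \<subseteq> I - {i} \<and> field_value (e c) t = c"
        using bchoice[of "set (coeffs p)" "\<lambda>c e. vars e \<subseteq> I - {i} \<and> field_value e t = c"] by blast
      have "map (\<lambda>e. field_value e t) (map e (coeffs p)) = coeffs p"
        using e by (simp add: map_idI)
      then have "P (map e (coeffs p)) t = p" by (simp only: P_def Poly_coeffs)
      then show "t \<in> (\<Union>es\<in>ES. N es)"
        using t(1) p(2,3) e by (intro UN_I[of "map e (coeffs p)"]) (auto simp: N_def ES_def)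
    qed
    ultimately show ?thesis
      using AE_I'[of _ "?M I" "\<lambda>t. \<not> algebraic_over (generated (I - {i}) t) (t i)"] by simp
  qed
  then show ?thesis
    unfolding generic_def by (rule AE_finite_allI[OF I])
qed

section \<open>Rank and controllability\<close>

lemma det_zero_row:
  fixes M :: "'a::comm_ring_1 mat"
  assumes "M \<in> carrier_mat n n" "k < n" "\<And>i. i < n \<Longrightarrow> M $$ (k, i) = 0"
  shows "det M = 0"
  unfolding det_def'[OF assms(1)]
proof (rule sum.neutral, intro ballI)
  fix p assume "p \<in> {p. p permutes {0..<n}}"
  then have "p k < n" using assms(2) permutes_in_image[of p "{0..<n}" k] by auto
  then have "(\<Prod>i = 0..<n. M $$ (i, p i)) = 0"
    using assms by (intro prod_zero) (auto intro!: bexI[of _ k])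
  then show "of_int (sign p) * (\<Prod>i = 0..<n. M $$ (i, p i)) = 0" by simp
qed

text \<open>Two descriptions of full row rank. The absence of a nonzero row vector that annihilates the matrix
  is suited to field isomorphisms, because such a vector can be transported. The nonvanishing of a
  maximal minor is suited to topology, because it is an open condition.\<close>

lemma full_row_rank_iff:
  fixes C :: "'a::field mat"
  assumes C: "C \<in> carrier_mat n nc"
  shows "vec_space.rank n C = n \<longleftrightarrow>
      (\<nexists>v. (\<exists>i<n. v i \<noteq> 0) \<and> (\<forall>j<nc. (\<Sum>i<n. v i * C $$ (i, j)) = 0))" (is "?R \<longleftrightarrow> ?K")
    and full_row_rank_iff_minor: "vec_space.rank n C = n \<longleftrightarrow>
      (\<exists>f. (\<forall>k<n. f k < nc) \<and> det (Matrix.mat n n (\<lambda>(i, k). C $$ (i, f k))) \<noteq> 0)" (is "_ \<longleftrightarrow> ?D")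
proof -
  interpret vec_space "TYPE('a)" n .
  \<comment> \<open>\<open>S\<close> is a basis of the column space that consists of columns.\<close>
  obtain S where S: "maximal S (\<lambda>T. T \<subseteq> set (cols C) \<and> lin_indpt T)"
    using maximal_exists_superset[of "set (cols C)" "\<lambda>T. T \<subseteq> set (cols C) \<and> lin_indpt T" "{}"]
    by (auto simp: finite_lin_indpt2)
  then have S_sub: "S \<subseteq> set (cols C)" and S_ind: "lin_indpt S"
    by (auto simp: maximal_def)
  have S_max: "T = S" if "S \<subseteq> T" "T \<subseteq> set (cols C)" "lin_indpt T" for T
    using S that by (auto simp: maximal_def)
  have cols: "set (cols C) \<subseteq> carrier_vec n" using C cols_dim by blast
  have S_carr: "S \<subseteq> carrier_vec n" using S_sub cols by blast
  have rank: "rank C = card S" by (rule rank_card_indpt[OF C S])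
  have finS: "finite S" using S_sub finite_subset by blast
  obtain ss where ss: "set ss = S" "distinct ss" using finite_distinct_list[OF finS] by blast
  have len: "length ss = card S" using ss distinct_card by fastforce
  have 1: ?D if "rank C = n"
  proof -
    define f where "f k = (SOME j. j < nc \<and> col C j = ss ! k)" for k
    have f: "f k < nc \<and> col C (f k) = ss ! k" if "k < n" for k
    proof -
      have "ss ! k \<in> set (cols C)"
        using that \<open>rank C = n\<close> rank len ss S_sub nth_mem[of k ss] by auto
      then have "\<exists>j. j < nc \<and> col C j = ss ! k"
        using C by (auto simp: cols_def)
      then show ?thesis unfolding f_def by (rule someI_ex)
    qed
    let ?M = "Matrix.mat n n (\<lambda>(i, k). C $$ (i, f k))"
    have M: "?M \<in> carrier_mat n n" by simp
    have colM: "col ?M k = ss ! k" if "k < n" for k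
    proof -
      have "f k < nc" using f[OF that] by blast
      then have "col ?M k = col C (f k)" using that C by (intro eq_vecI) auto
      then show ?thesis using f[OF that] by simp
    qed
    have "cols ?M = ss"
      using len rank \<open>rank C = n\<close> colM by (intro nth_equalityI) auto
    then have "rank ?M = n" using lin_indpt_full_rank[OF M] ss S_ind by simp
    then have "det ?M \<noteq> 0" using det_rank_iff[OF M] by simp
    then show ?D using f by blast
  qed
  have 2: ?K if D: ?D
  proof
    assume "\<exists>v. (\<exists>i<n. v i \<noteq> 0) \<and> (\<forall>j<nc. (\<Sum>i<n. v i * C $$ (i, j)) = 0)"
    then obtain v i0 where v: "i0 < n" "v i0 \<noteq> 0" "\<forall>j<nc. (\<Sum>i<n. v i * C $$ (i, j)) = 0" by blast
    obtain f where f: "\<forall>k<n. f k < nc" "det (Matrix.mat n n (\<lambda>(i, k). C $$ (i, f k))) \<noteq> 0"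
      using D by blast
    let ?M = "Matrix.mat n n (\<lambda>(i, k). C $$ (i, f k))"
    have Mt: "transpose_mat ?M \<in> carrier_mat n n" by simp
    let ?u = "Matrix.vec n v"
    have "transpose_mat ?M *\<^sub>v ?u = 0\<^sub>v n"
    proof (intro eq_vecI)
      fix k assume "k < dim_vec (0\<^sub>v n :: 'a vec)"
      then have k: "k < n" by simp
      then have "(transpose_mat ?M *\<^sub>v ?u) $ k = (\<Sum>i = 0..<n. C $$ (i, f k) * v i)"
        by (simp add: scalar_prod_def)
      also have "\<dots> = (\<Sum>i<n. v i * C $$ (i, f k))"
        by (intro sum.cong) auto
      also have "\<dots> = 0" using v(3) f(1) k by blast
      finally show "(transpose_mat ?M *\<^sub>v ?u) $ k = 0\<^sub>v n $ k" using k by simp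
    qed simp
    moreover have "?u \<noteq> 0\<^sub>v n"
    proof
      assume "?u = 0\<^sub>v n"
      then have "?u $ i0 = 0\<^sub>v n $ i0" by (rule arg_cong)
      then show False using v(1,2) by simp
    qed
    ultimately have "det (transpose_mat ?M) = 0"
      using det_0_iff_vec_prod_zero_field[OF Mt] vec_carrier[of n v] by blast
    then show False using f(2) det_transpose[of ?M n] by simp
  qed
  have 3: "rank C = n" if K: ?K
  proof (rule ccontr)
    assume ne: "rank C \<noteq> n"
    have "card S \<le> n" using li_le_dim(2)[OF fin_dim S_carr S_ind] dim_is_n by simp
    then have less: "card S < n" using ne rank by simp
    \<comment> \<open>Fewer than \<open>n\<close> basis columns, padded with zero rows, give a singular square matrix.\<close>
    define M where "M = Matrix.mat n n (\<lambda>(k, i). if k < length ss then (ss ! k) $ i else 0)"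
    have M: "M \<in> carrier_mat n n" by (simp add: M_def)
    have "det M = 0"
      by (rule det_zero_row[OF M less]) (use less len in \<open>auto simp: M_def\<close>)
    then obtain u where u: "u \<in> carrier_vec n" "u \<noteq> 0\<^sub>v n" "M *\<^sub>v u = 0\<^sub>v n"
      using det_0_iff_vec_prod_zero_field[OF M] by auto
    have "u \<bullet> s = 0" if "s \<in> S" for s
    proof -
      have "s \<in> set ss" using that ss(1) by simp
      then obtain k where k: "k < length ss" "s = ss ! k" by (auto simp: in_set_conv_nth)
      then have kn: "k < n" using len less by simp
      have s: "s \<in> carrier_vec n" using S_carr that by blast
      have "row M k = s" using k kn s by (intro eq_vecI) (auto simp: M_def)
      then have "s \<bullet> u = (M *\<^sub>v u) $ k" using kn M by simp
      then show ?thesis using u kn s by (simp add: comm_scalar_prod[OF u(1) s])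
    qed
    then have "u \<in> orthogonal_complement S" using u(1) by (simp add: orthogonal_complement_def)
    then have orth: "u \<in> orthogonal_complement (span S)" using in_orthogonal_complement_span[OF S_carr] by simp
    have span: "c \<in> span S" if c: "c \<in> set (cols C)" for c
    proof (cases "c \<in> S")
      case True
      then show ?thesis using in_own_span[OF S_carr] by blast
    next
      case False
      then have "lin_dep (S \<union> {c})" using S_max[of "S \<union> {c}"] S_sub c by blast
      then show ?thesis using lin_dep_iff_in_span[OF S_carr S_ind _ False] cols c by blast
    qed
    have "(\<Sum>i<n. u $ i * C $$ (i, j)) = 0" if j: "j < nc" for j
    proof -
      have "col C j \<in> set (cols C)" using j C by (auto simp: cols_def)
      then have "u \<bullet> col C j = 0" using orth span by (auto simp: orthogonal_complement_def)
      moreover have "u \<bullet> col C j = (\<Sum>i<n. u $ i * C $$ (i, j))"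
        using C j by (auto simp: scalar_prod_def atLeast0LessThan intro!: sum.cong)
      ultimately show ?thesis by simp
    qed
    moreover have "\<exists>i<n. u $ i \<noteq> 0"
    proof (rule ccontr)
      assume "\<not> (\<exists>i<n. u $ i \<noteq> 0)"
      then have "u = 0\<^sub>v n" using u(1) by (intro eq_vecI) auto
      then show False using u(2) by blast
    qed
    ultimately show False using K by blast
  qed
  show "rank C = n \<longleftrightarrow> ?K" "rank C = n \<longleftrightarrow> ?D" using 1 2 3 by blast+
qed

lemma controllability_mat_carrier:
  "A \<in> carrier_mat n n \<Longrightarrow> B \<in> carrier_mat n m \<Longrightarrow> controllability_mat A B \<in> carrier_mat n (n * m)"
  by (simp add: controllability_mat_def Let_def)

lemma controllability_mat_index:
  assumes "A \<in> carrier_mat n n" "B \<in> carrier_mat n m" "i < n" "j < n * m"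
  shows "controllability_mat A B $$ (i, j) = (A ^\<^sub>m (j div m) * B) $$ (i, j mod m)"
  using assms by (simp add: controllability_mat_def Let_def)

lemma not_controllable_iff:
  assumes A: "A \<in> carrier_mat n n" and B: "B \<in> carrier_mat n m"
  shows "\<not> controllable A B \<longleftrightarrow>
    (\<exists>v. (\<exists>i<n. v i \<noteq> 0) \<and> (\<forall>k<n. \<forall>l<m. (\<Sum>i<n. v i * (A ^\<^sub>m k * B) $$ (i, l)) = 0))"
proof -
  have "(\<forall>j<n * m. (\<Sum>i<n. v i * controllability_mat A B $$ (i, j)) = 0) \<longleftrightarrow>
      (\<forall>k<n. \<forall>l<m. (\<Sum>i<n. v i * (A ^\<^sub>m k * B) $$ (i, l)) = 0)" (is "?L \<longleftrightarrow> ?R") for v :: "nat \<Rightarrow> complex"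
  proof
    assume L: ?L
    show ?R
    proof (intro allI impI)
      fix k l assume kl: "k < n" "l < m"
      have j: "k * m + l < n * m"
      proof -
        have "k * m + l < Suc k * m" using kl by simp
        also have "\<dots> \<le> n * m" using kl by (intro mult_le_mono1) simp
        finally show ?thesis .
      qed
      have "(k * m + l) div m = k" "(k * m + l) mod m = l" using kl by auto
      then show "(\<Sum>i<n. v i * (A ^\<^sub>m k * B) $$ (i, l)) = 0"
        using L[rule_format, OF j] controllability_mat_index[OF A B _ j] by simp
    qed
  next
    assume R: ?R
    show ?L
    proof (intro allI impI)
      fix j assume j: "j < n * m"
      then have "m > 0" by (cases m) auto
      then have "j div m < n" "j mod m < m" using j by (auto simp: less_mult_imp_div_less)
      then show "(\<Sum>i<n. v i * controllability_mat A B $$ (i, j)) = 0"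
        using R controllability_mat_index[OF A B _ j] by simp
    qed
  qed
  then show ?thesis
    using full_row_rank_iff[OF controllability_mat_carrier[OF A B]] A
    unfolding controllable_def by auto
qed

lemma controllable_iff_minor:
  assumes A: "A \<in> carrier_mat n n" and B: "B \<in> carrier_mat n m"
  shows "controllable A B \<longleftrightarrow> (\<exists>f. (\<forall>k<n. f k < n * m) \<and>
    det (Matrix.mat n n (\<lambda>(i, k). (A ^\<^sub>m (f k div m) * B) $$ (i, f k mod m))) \<noteq> 0)"
proof -
  have "Matrix.mat n n (\<lambda>(i, k). controllability_mat A B $$ (i, f k)) =
      Matrix.mat n n (\<lambda>(i, k). (A ^\<^sub>m (f k div m) * B) $$ (i, f k mod m))"
    if "\<forall>k<n. f k < n * m" for f
    using that by (intro eq_matI) (auto simp: controllability_mat_index[OF A B])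
  then show ?thesis
    unfolding controllable_def carrier_matD(1)[OF A]
      full_row_rank_iff_minor[OF controllability_mat_carrier[OF A B]]
    by (intro iff_exI conj_cong refl) simp
qed

section \<open>Sets of positive measure and continuity of minors\<close>

lemma emeasure_lborel_open_pos:
  fixes U :: "'a::euclidean_space set"
  assumes "open U" "U \<noteq> {}"
  shows "emeasure lborel U \<noteq> 0"
proof
  assume "emeasure lborel U = 0"
  then have "U \<in> null_sets lebesgue"
    using assms by (intro null_sets_completionI null_setsI) auto
  then show False using open_not_negligible[OF assms] by (simp add: negligible_iff_null_sets)
qed

text \<open>A nonempty open set contains a nonempty open box, whose part over the finitely many
  coordinates in \<open>I\<close> has positive measure.
  The set \<open>U\<close> lives in the space of all functions, whereas points of the product space are
  \<open>undefined\<close> outside \<open>I\<close>; hence the restriction.\<close>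

lemma AE_product_lborel_meets_open:
  fixes U :: "('i \<Rightarrow> 'a::euclidean_space) set"
  assumes I: "finite I" and U: "open U" "t0 \<in> U"
    and AE: "AE t in Pi\<^sub>M I (\<lambda>_. lborel). P t"
  shows "\<exists>t\<in>U. P (restrict t I)"
proof (rule ccontr)
  assume contr: "\<not> ?thesis"
  interpret product_sigma_finite "\<lambda>_::'i. lborel :: 'a measure" ..
  let ?M = "Pi\<^sub>M I (\<lambda>_. lborel :: 'a measure)"
  obtain X where X: "t0 \<in> PiE UNIV X" "\<forall>i. open (X i)" "PiE UNIV X \<subseteq> U"
    using product_topology_open_contains_basis[of "\<lambda>_. euclidean" UNIV U t0] U
    unfolding open_fun_def by auto
  have sets: "PiE I X \<in> sets ?M"
    using X(2) by (intro sets_PiM_I_finite I) auto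
  have "\<not> P t" if "t \<in> PiE I X" for t
  proof -
    have "(\<lambda>i. if i \<in> I then t i else t0 i) \<in> U"
      using that X(1,3) by (auto simp: PiE_def Pi_def)
    moreover have "restrict (\<lambda>i. if i \<in> I then t i else t0 i) I = t"
      using that by (auto simp: restrict_def PiE_def extensional_def fun_eq_iff)
    ultimately show ?thesis using contr by metis
  qed
  then have "AE t in ?M. t \<notin> PiE I X" using AE by (auto elim: eventually_mono)
  then have "emeasure ?M (PiE I X) = 0"
    using AE_iff_null_sets[OF sets] by (simp add: null_setsD1)
  moreover have "emeasure ?M (PiE I X) = (\<Prod>i\<in>I. emeasure lborel (X i))"
    using X(2) by (intro emeasure_PiM I) auto
  moreover have "emeasure lborel (X i) \<noteq> 0" for i
    using emeasure_lborel_open_pos[of "X i"] X(1,2) by auto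
  ultimately show False using I by simp
qed

lemma continuous_on_mat_mult:
  fixes A B :: "'t::topological_space \<Rightarrow> 'a::real_normed_field mat"
  assumes carr: "\<And>t. A t \<in> carrier_mat nr n" "\<And>t. B t \<in> carrier_mat n nc"
    and A: "\<And>i j. i < nr \<Longrightarrow> j < n \<Longrightarrow> continuous_on S (\<lambda>t. A t $$ (i, j))"
    and B: "\<And>i j. i < n \<Longrightarrow> j < nc \<Longrightarrow> continuous_on S (\<lambda>t. B t $$ (i, j))"
    and ij: "i < nr" "j < nc"
  shows "continuous_on S (\<lambda>t. (A t * B t) $$ (i, j))"
proof -
  have "(A t * B t) $$ (i, j) = (\<Sum>l = 0..<n. A t $$ (i, l) * B t $$ (l, j))" for t
    using carr[of t] ij by (simp add: scalar_prod_def)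
  then show ?thesis
    using ij by (auto intro!: continuous_intros A B)
qed

lemma continuous_on_mat_power:
  fixes A :: "'t::topological_space \<Rightarrow> 'a::real_normed_field mat"
  assumes carr: "\<And>t. A t \<in> carrier_mat n n"
    and A: "\<And>i j. i < n \<Longrightarrow> j < n \<Longrightarrow> continuous_on S (\<lambda>t. A t $$ (i, j))"
  shows "i < n \<Longrightarrow> j < n \<Longrightarrow> continuous_on S (\<lambda>t. (A t ^\<^sub>m k) $$ (i, j))"
proof (induction k arbitrary: i j)
  case 0
  then show ?case using carr by (simp add: carrier_matD[OF carr])
next
  case (Suc k)
  then show ?case
    using continuous_on_mat_mult[of "\<lambda>t. A t ^\<^sub>m k" n n A n S i j] carr A by (simp add: pow_carrier_mat)
qed

lemma continuous_on_det:
  fixes M :: "'t::topological_space \<Rightarrow> 'a::real_normed_field mat"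
  assumes carr: "\<And>t. M t \<in> carrier_mat n n"
    and M: "\<And>i j. i < n \<Longrightarrow> j < n \<Longrightarrow> continuous_on S (\<lambda>t. M t $$ (i, j))"
  shows "continuous_on S (\<lambda>t. det (M t))"
  unfolding det_def'[OF carr]
proof (intro continuous_intros M)
  fix p i assume "p \<in> {p. p permutes {0..<n}}" "i \<in> {0..<n}"
  then show "i < n" "p i < n" using permutes_in_image[of p "{0..<n}" i] by auto
qed

section \<open>Field isomorphisms and matrices\<close>

definition mat_over :: "'a set \<Rightarrow> 'a mat \<Rightarrow> bool" where
  "mat_over K M \<longleftrightarrow> (\<forall>i<dim_row M. \<forall>j<dim_col M. M $$ (i, j) \<in> K)"

lemma mat_over_mono: "K \<subseteq> L \<Longrightarrow> mat_over K M \<Longrightarrow> mat_over L M"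
  by (auto simp: mat_over_def)

context field_embedding
begin

lemma mat_over_mult:
  assumes "A \<in> carrier_mat nr n" "B \<in> carrier_mat n nc" "mat_over K A" "mat_over K B"
  shows "mat_over K (A * B)"
  using assms by (auto simp: mat_over_def scalar_prod_def intro!: K_closed)

lemma map_mat_mult:
  assumes "A \<in> carrier_mat nr n" "B \<in> carrier_mat n nc" "mat_over K A" "mat_over K B"
  shows "map_mat \<sigma> (A * B) = map_mat \<sigma> A * map_mat \<sigma> B"
proof (intro eq_matI)
  fix i j assume "i < dim_row (map_mat \<sigma> A * map_mat \<sigma> B)" "j < dim_col (map_mat \<sigma> A * map_mat \<sigma> B)"
  then have ij: "i < nr" "j < nc" using assms(1,2) by auto
  have "\<sigma> (\<Sum>l = 0..<n. A $$ (i, l) * B $$ (l, j)) = (\<Sum>l = 0..<n. \<sigma> (A $$ (i, l)) * \<sigma> (B $$ (l, j)))"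
    using assms ij by (subst sum) (auto simp: mat_over_def mult K_closed)
  then show "map_mat \<sigma> (A * B) $$ (i, j) = (map_mat \<sigma> A * map_mat \<sigma> B) $$ (i, j)"
    using assms(1,2) ij by (simp add: scalar_prod_def)
qed (use assms in auto)

lemma map_mat_add:
  assumes "A \<in> carrier_mat nr nc" "B \<in> carrier_mat nr nc" "mat_over K A" "mat_over K B"
  shows "map_mat \<sigma> (A + B) = map_mat \<sigma> A + map_mat \<sigma> B"
  using assms by (intro eq_matI) (auto simp: mat_over_def add)

lemma mat_over_add:
  assumes "A \<in> carrier_mat nr nc" "B \<in> carrier_mat nr nc" "mat_over K A" "mat_over K B"
  shows "mat_over K (A + B)"
  using assms by (auto simp: mat_over_def K_closed)

lemma map_mat_power:
  assumes "A \<in> carrier_mat n n" "mat_over K A"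
  shows "mat_over K (A ^\<^sub>m k) \<and> map_mat \<sigma> (A ^\<^sub>m k) = map_mat \<sigma> A ^\<^sub>m k"
proof (induction k)
  case 0
  have "map_mat \<sigma> (1\<^sub>m n) = 1\<^sub>m n"
    by (intro eq_matI) (auto simp: zero one)
  then show ?case using assms(1) by (auto simp: mat_over_def K_closed)
next
  case (Suc k)
  have "A ^\<^sub>m k \<in> carrier_mat n n" using assms(1) by (rule pow_carrier_mat)
  then show ?case
    using Suc assms mat_over_mult[of "A ^\<^sub>m k" n n A n] map_mat_mult[of "A ^\<^sub>m k" n n A n] by simp
qed

text \<open>A row vector that annihilates the controllability matrix may have entries outside \<open>K\<close>. After
  extending \<open>\<sigma>\<close> to a field containing them, its image annihilates the image of the controllability
  matrix, and it is still nonzero.\<close>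

lemma not_controllable_map:
  assumes A: "A \<in> carrier_mat n n" "mat_over K A" and B: "B \<in> carrier_mat n m" "mat_over K B"
    and K: "countable K" and nc: "\<not> controllable A B"
  shows "\<not> controllable (map_mat \<sigma> A) (map_mat \<sigma> B)"
proof -
  obtain v i0 where v: "i0 < n" "v i0 \<noteq> 0"
    "\<And>k l. k < n \<Longrightarrow> l < m \<Longrightarrow> (\<Sum>i<n. v i * (A ^\<^sub>m k * B) $$ (i, l)) = 0"
    using nc unfolding not_controllable_iff[OF A(1) B(1)] by blast
  obtain L \<tau> where L: "field_embedding L \<tau>" "\<forall>x\<in>K. \<tau> x = \<sigma> x" "K \<union> v ` {..<n} \<subseteq> L"
    using field_embedding_extends_to_finite[of "v ` {..<n}" K \<sigma>] K field_embedding_axioms by auto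
  interpret L: field_embedding L \<tau> by (rule L(1))
  have vL: "v i \<in> L" if "i < n" for i using that L(3) by auto
  have map_eq: "map_mat \<tau> M = map_mat \<sigma> M" if "mat_over K M" for M
    using that L(2) by (intro eq_matI) (auto simp: mat_over_def)
  have AB: "A ^\<^sub>m k \<in> carrier_mat n n" "mat_over K (A ^\<^sub>m k * B)"
    "map_mat \<sigma> (A ^\<^sub>m k * B) = map_mat \<sigma> A ^\<^sub>m k * map_mat \<sigma> B" for k
  proof -
    show c: "A ^\<^sub>m k \<in> carrier_mat n n" using A(1) by (rule pow_carrier_mat)
    show "mat_over K (A ^\<^sub>m k * B)"
      using map_mat_power[OF A] B c by (intro mat_over_mult) auto
    show "map_mat \<sigma> (A ^\<^sub>m k * B) = map_mat \<sigma> A ^\<^sub>m k * map_mat \<sigma> B"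
      using map_mat_power[OF A, of k] map_mat_mult[OF c B(1) _ B(2)] by simp
  qed
  have "(\<Sum>i<n. \<tau> (v i) * (map_mat \<sigma> A ^\<^sub>m k * map_mat \<sigma> B) $$ (i, l)) = 0"
    if kl: "k < n" "l < m" for k l
  proof -
    have entry: "(A ^\<^sub>m k * B) $$ (i, l) \<in> L" if "i < n" for i
    proof -
      have "A ^\<^sub>m k * B \<in> carrier_mat n m" using AB(1) B(1) by (rule mult_carrier_mat)
      then have "(A ^\<^sub>m k * B) $$ (i, l) \<in> K"
        using AB(2)[of k] that kl(2) unfolding mat_over_def by (simp only: carrier_matD)
      then show ?thesis using L(3) by blast
    qed
    have "(\<Sum>i<n. \<tau> (v i) * (map_mat \<sigma> A ^\<^sub>m k * map_mat \<sigma> B) $$ (i, l)) =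
        (\<Sum>i<n. \<tau> (v i * (A ^\<^sub>m k * B) $$ (i, l)))"
    proof (intro sum.cong refl)
      fix i assume "i \<in> {..<n}"
      then have i: "i < n" by simp
      have "(map_mat \<sigma> A ^\<^sub>m k * map_mat \<sigma> B) $$ (i, l) = map_mat \<tau> (A ^\<^sub>m k * B) $$ (i, l)"
        by (simp only: AB(3) map_eq[OF AB(2)])
      also have "\<dots> = \<tau> ((A ^\<^sub>m k * B) $$ (i, l))"
        by (rule index_map_mat) (use A(1) B(1) i kl in auto)
      finally show "\<tau> (v i) * (map_mat \<sigma> A ^\<^sub>m k * map_mat \<sigma> B) $$ (i, l) =
          \<tau> (v i * (A ^\<^sub>m k * B) $$ (i, l))"
        using L.mult[OF vL[OF i] entry[OF i]] by simp
    qed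
    also have "\<dots> = \<tau> (\<Sum>i<n. v i * (A ^\<^sub>m k * B) $$ (i, l))"
      using vL entry by (subst L.sum) (auto simp: L.K_closed)
    finally show ?thesis using v(3)[OF kl] L.zero by simp
  qed
  moreover have "\<tau> (v i0) \<noteq> 0" using L.eq_0_iff[OF vL[OF v(1)]] v(2) by simp
  ultimately have "(\<exists>i<n. \<tau> (v i) \<noteq> 0) \<and> (\<forall>k<n. \<forall>l<m.
      (\<Sum>i<n. \<tau> (v i) * (map_mat \<sigma> A ^\<^sub>m k * map_mat \<sigma> B) $$ (i, l)) = 0)"
    using v(1) by blast
  moreover have "map_mat \<sigma> A \<in> carrier_mat n n" "map_mat \<sigma> B \<in> carrier_mat n m"
    using A(1) B(1) by auto
  ultimately show ?thesis
    by (subst not_controllable_iff[of _ n _ m]) (assumption | rule exI[of _ "\<lambda>i. \<tau> (v i)"])+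
qed

end

lemma append_cols_carrier:
  "M \<in> carrier_mat n p \<Longrightarrow> N \<in> carrier_mat n q \<Longrightarrow> M @\<^sub>c N \<in> carrier_mat n (p + q)"
  by (auto simp: append_cols_def)

lemma append_cols_index:
  assumes "M \<in> carrier_mat n p" "N \<in> carrier_mat n q" "i < n"
  shows "j < p \<Longrightarrow> (M @\<^sub>c N) $$ (i, j) = M $$ (i, j)"
    and "j < q \<Longrightarrow> (M @\<^sub>c N) $$ (i, p + j) = N $$ (i, j)"
  using assms by (auto simp: append_cols_def)

lemma map_append_cols:
  assumes "M \<in> carrier_mat n p" "N \<in> carrier_mat n q"
  shows "map_mat f (M @\<^sub>c N) = map_mat f M @\<^sub>c map_mat f N"
  using assms by (intro eq_matI) (auto simp: append_cols_def)

lemma append_cols_inject: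
  assumes M: "M \<in> carrier_mat n p" "M' \<in> carrier_mat n p"
    and N: "N \<in> carrier_mat n q" "N' \<in> carrier_mat n q"
    and eq: "M @\<^sub>c N = M' @\<^sub>c N'"
  shows "M = M'" "N = N'"
proof -
  show "M = M'"
    using M append_cols_index(1)[OF M(1) N(1)] append_cols_index(1)[OF M(2) N(2)] eq
    by (intro eq_matI) auto
  show "N = N'"
    using N append_cols_index(2)[OF M(1) N(1)] append_cols_index(2)[OF M(2) N(2)] eq
    by (intro eq_matI) auto
qed

lemma mat_over_append_colsD:
  assumes M: "M \<in> carrier_mat n p" and N: "N \<in> carrier_mat n q" and over: "mat_over K (M @\<^sub>c N)"
  shows "mat_over K M" "mat_over K N"
proof -
  have MN: "(M @\<^sub>c N) $$ (i, j) \<in> K" if "i < n" "j < p + q" for i j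
    using over that append_cols_carrier[OF M N] by (auto simp: mat_over_def)
  show "mat_over K M"
    unfolding mat_over_def
  proof (intro allI impI)
    fix i j assume "i < dim_row M" "j < dim_col M"
    then show "M $$ (i, j) \<in> K" using MN[of i j] append_cols_index(1)[OF M N, of i j] M by simp
  qed
  show "mat_over K N"
    unfolding mat_over_def
  proof (intro allI impI)
    fix i j assume "i < dim_row N" "j < dim_col N"
    then show "N $$ (i, j) \<in> K" using MN[of i "p + j"] append_cols_index(2)[OF M N, of i j] N by simp
  qed
qed

section \<open>Perturbation tolerance at generic realizations\<close>

lemma PTC_carrier:
  assumes "A \<in> carrier_mat n n" "B \<in> carrier_mat n m"
  shows "PTC SF A B \<longleftrightarrow> (\<forall>DA\<in>carrier_mat n n. \<forall>DB\<in>carrier_mat n m.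
    DA @\<^sub>c DB \<in> realizations SF \<longrightarrow> controllable (A + DA) (B + DB))"
  using assms by (auto simp: PTC_def)

lemma realizations_map:
  assumes "f 0 = 0" "M \<in> realizations S"
  shows "map_mat f M \<in> realizations S"
  using assms by (auto simp: realizations_def)

text \<open>A perturbation that destroys controllability is transported in the same way, after extending \<open>\<sigma>\<close>
  to its entries. The perturbation structure is respected because \<open>0\<close> is mapped to \<open>0\<close>.\<close>

lemma not_PTC_map:
  assumes "field_embedding K \<sigma>" and K: "countable K"
    and A: "A \<in> carrier_mat n n" "mat_over K A" and B: "B \<in> carrier_mat n m" "mat_over K B"
    and not_PTC: "\<not> PTC SF A B"
  shows "\<not> PTC SF (map_mat \<sigma> A) (map_mat \<sigma> B)"
proof -
  interpret field_embedding K \<sigma> by fact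
  obtain DA DB where D: "DA \<in> carrier_mat n n" "DB \<in> carrier_mat n m"
    "DA @\<^sub>c DB \<in> realizations SF" "\<not> controllable (A + DA) (B + DB)"
    using not_PTC unfolding PTC_carrier[OF A(1) B(1)] by blast
  define X where "X = (\<lambda>p. DA $$ p) ` ({..<n} \<times> {..<n}) \<union> (\<lambda>p. DB $$ p) ` ({..<n} \<times> {..<m})"
  have "finite X" by (simp add: X_def)
  then obtain L \<tau> where L: "field_embedding L \<tau>" "countable L" "\<forall>x\<in>K. \<tau> x = \<sigma> x" "K \<union> X \<subseteq> L"
    using field_embedding_extends_to_finite[of X K \<sigma>] K field_embedding_axioms by auto
  interpret L: field_embedding L \<tau> by (rule L(1))
  have DL: "mat_over L DA" "mat_over L DB"
    using D(1,2) L(4) by (auto simp: mat_over_def X_def)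
  have AL: "mat_over L A" "mat_over L B" using A(2) B(2) L(4) mat_over_mono[of K L] by auto
  have map_eq: "map_mat \<tau> M = map_mat \<sigma> M" if "mat_over K M" for M
    using that L(3) by (intro eq_matI) (auto simp: mat_over_def)
  have "\<not> controllable (map_mat \<tau> (A + DA)) (map_mat \<tau> (B + DB))"
    using A(1) B(1) D AL DL
    by (intro L.not_controllable_map[OF _ _ _ _ L(2)] L.mat_over_add add_carrier_mat) auto
  then have "\<not> controllable (map_mat \<sigma> A + map_mat \<tau> DA) (map_mat \<sigma> B + map_mat \<tau> DB)"
    using L.map_mat_add[OF A(1) D(1) AL(1) DL(1)] L.map_mat_add[OF B(1) D(2) AL(2) DL(2)]
      map_eq[OF A(2)] map_eq[OF B(2)] by simp
  moreover have "map_mat \<tau> DA @\<^sub>c map_mat \<tau> DB \<in> realizations SF"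
    using realizations_map[of \<tau>, OF L.zero D(3)] map_append_cols[OF D(1,2), of \<tau>] by simp
  moreover have carr: "map_mat \<sigma> A \<in> carrier_mat n n" "map_mat \<sigma> B \<in> carrier_mat n m"
    "map_mat \<tau> DA \<in> carrier_mat n n" "map_mat \<tau> DB \<in> carrier_mat n m"
    using A(1) B(1) D(1,2) by auto
  ultimately show ?thesis unfolding PTC_carrier[OF carr(1,2)] by blast
qed

lemma realization_entry:
  assumes "M \<in> realizations S" "i < dim_row S" "j < dim_col S"
  shows "M $$ (i, j) = (if (i, j) \<in> star_positions S then parameters S M (i, j) else 0)"
  using assms by (cases "S $$ (i, j)") (auto simp: realizations_def star_positions_def parameters_def)

lemma generic_not_PTC_invariant:
  fixes S :: "entry mat"
  assumes AB: "A \<in> carrier_mat n n" "B \<in> carrier_mat n m" "A @\<^sub>c B \<in> realizations S"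
    and AB': "A' \<in> carrier_mat n n" "B' \<in> carrier_mat n m" "A' @\<^sub>c B' \<in> realizations S"
    and gen: "generic (star_positions S) (parameters S (A @\<^sub>c B))"
      "generic (star_positions S) (parameters S (A' @\<^sub>c B'))"
    and not_PTC: "\<not> PTC SF A B"
  shows "\<not> PTC SF A' B'"
proof -
  let ?M = "A @\<^sub>c B" and ?M' = "A' @\<^sub>c B'"
  obtain K \<sigma> where K: "field_embedding K \<sigma>" "countable K"
    "\<forall>p\<in>star_positions S. parameters S ?M p \<in> K \<and> \<sigma> (parameters S ?M p) = parameters S ?M' p"
    using generic_points_conjugate[OF finite_star_positions gen] by blast
  interpret field_embedding K \<sigma> by (rule K(1))
  have dim: "?M \<in> carrier_mat (dim_row S) (dim_col S)" "?M' \<in> carrier_mat (dim_row S) (dim_col S)"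
    using AB(3) AB'(3) by (auto simp: realizations_def)
  have "mat_over K ?M"
    unfolding mat_over_def using dim(1) K(3) K_closed(1)
    by (auto simp: realization_entry[OF AB(3)])
  then have over: "mat_over K A" "mat_over K B" using mat_over_append_colsD[OF AB(1,2)] by blast+
  have "map_mat \<sigma> ?M = ?M'"
    using dim K(3) zero
    by (intro eq_matI) (auto simp: realization_entry[OF AB(3)] realization_entry[OF AB'(3)])
  then have "map_mat \<sigma> A @\<^sub>c map_mat \<sigma> B = A' @\<^sub>c B'"
    using map_append_cols[OF AB(1,2), of \<sigma>] by simp
  then have "map_mat \<sigma> A = A'" "map_mat \<sigma> B = B'"
    using append_cols_inject[of "map_mat \<sigma> A" n n A' "map_mat \<sigma> B" m B'] AB AB' by auto
  then show ?thesis
    using not_PTC_map[OF K(1,2) AB(1) over(1) AB(2) over(2) not_PTC] by simp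
qed

section \<open>The dichotomy\<close>

text \<open>Controllable realizations form a set of positive measure: the minor that is nonzero at the given
  controllable realization depends continuously on the parameters.\<close>

lemma controllable_realizations_not_null:
  fixes SA SB :: "entry mat"
  assumes SA: "SA \<in> carrier_mat n n" and SB: "SB \<in> carrier_mat n m"
    and sc: "structurally_controllable SA SB"
    and AE: "AE t in parameter_measure (SA @\<^sub>c SB).
      \<forall>(A, B)\<in>CS SA SB. parameters (SA @\<^sub>c SB) (A @\<^sub>c B) \<noteq> t"
  shows False
proof -
  let ?S = "SA @\<^sub>c SB"
  let ?I = "star_positions ?S"
  have S: "?S \<in> carrier_mat n (n + m)" using append_cols_carrier[OF SA SB] .
  obtain A0 B0 where A0: "A0 \<in> carrier_mat n n" and B0: "B0 \<in> carrier_mat n m"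
    and AB0: "A0 @\<^sub>c B0 \<in> realizations ?S" "controllable A0 B0"
    using sc SA SB unfolding structurally_controllable_def by auto
  obtain f where f: "\<forall>k<n. f k < n * m"
    "det (Matrix.mat n n (\<lambda>(i, k). (A0 ^\<^sub>m (f k div m) * B0) $$ (i, f k mod m))) \<noteq> 0"
    using AB0(2) unfolding controllable_iff_minor[OF A0 B0] by blast
  \<comment> \<open>The realization with parameters \<open>t\<close> is \<open>A t\<close>, \<open>B t\<close>; its entries are the values of \<open>c t\<close>.\<close>
  define c where "c t p = (if p \<in> ?I then t p else 0)" for t :: "nat \<times> nat \<Rightarrow> complex" and p
  define A where "A t = Matrix.mat n n (c t)" for t
  define B where "B t = Matrix.mat n m (\<lambda>(i, j). c t (i, n + j))" for t
  define g where "g t = det (Matrix.mat n n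
      (\<lambda>(i, k). (A t ^\<^sub>m (f k div m) * B t) $$ (i, f k mod m)))" for t
  have carr: "A t \<in> carrier_mat n n" "B t \<in> carrier_mat n m" for t
    by (simp_all add: A_def B_def)
  have AB: "A t @\<^sub>c B t = Matrix.mat n (n + m) (c t)" for t
    by (intro eq_matI) (auto simp: append_cols_def A_def B_def)
  have real: "A t @\<^sub>c B t \<in> realizations ?S" for t
    unfolding AB using S by (auto simp: realizations_def c_def star_positions_def)
  have par: "parameters ?S (A t @\<^sub>c B t) = restrict t ?I" for t
    unfolding AB parameters_def using S by (auto simp: c_def star_positions_def restrict_def fun_eq_iff)
  let ?t0 = "parameters ?S (A0 @\<^sub>c B0)"
  have "A ?t0 @\<^sub>c B ?t0 = A0 @\<^sub>c B0"
    unfolding AB using S append_cols_carrier[OF A0 B0]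
    by (intro eq_matI) (auto simp: c_def realization_entry[OF AB0(1)])
  then have "A ?t0 = A0" "B ?t0 = B0"
    using append_cols_inject[OF carr(1) A0 carr(2) B0] by auto
  then have g0: "g ?t0 \<noteq> 0" using f(2) by (simp add: g_def)
  have c_cont: "continuous_on UNIV (\<lambda>t. c t p)" for p
    by (cases "p \<in> ?I") (simp_all add: c_def)
  have A_cont: "continuous_on UNIV (\<lambda>t. A t $$ (i, j))" if "i < n" "j < n" for i j
    using that c_cont by (simp add: A_def)
  have B_cont: "continuous_on UNIV (\<lambda>t. B t $$ (i, j))" if "i < n" "j < m" for i j
    using that c_cont by (simp add: B_def)
  have "continuous_on UNIV g"
    unfolding g_def
  proof (rule continuous_on_det)
    fix i k assume ik: "i < n" "k < n"
    then have "0 < m" using f(1) by (cases m) auto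
    then have "f k mod m < m" by simp
    then have "continuous_on UNIV (\<lambda>t. (A t ^\<^sub>m (f k div m) * B t) $$ (i, f k mod m))"
      using ik(1)
      by (intro continuous_on_mat_mult[OF pow_carrier_mat[OF carr(1)] carr(2)]
          continuous_on_mat_power[OF carr(1)] A_cont B_cont)
    then show "continuous_on UNIV (\<lambda>t. Matrix.mat n n
        (\<lambda>(i, k). (A t ^\<^sub>m (f k div m) * B t) $$ (i, f k mod m)) $$ (i, k))"
      using ik by simp
  qed simp
  then have "open {t. g t \<noteq> 0}" by (intro open_Collect_neq) auto
  from AE_product_lborel_meets_open[OF finite_star_positions this _ AE[unfolded parameter_measure_def]]
  obtain t where t: "g t \<noteq> 0"
    "\<forall>(A, B)\<in>CS SA SB. parameters ?S (A @\<^sub>c B) \<noteq> restrict t ?I"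
    using g0 by blast
  have "controllable (A t) (B t)"
    using t(1) f(1) unfolding controllable_iff_minor[OF carr] g_def by blast
  then have "(A t, B t) \<in> CS SA SB"
    using carr real SA SB by (auto simp: CS_def)
  then show False using t(2) par by auto
qed

theorem theorem1:
  fixes n m :: nat and SA SB SF :: "entry mat"
  assumes "SA \<in> carrier_mat n n"
    and "SB \<in> carrier_mat n m"
    and "SF \<in> carrier_mat n (n + m)"
    and "structurally_controllable SA SB"
  shows "(for_almost_all_CS SA SB (PTC SF) \<or> for_almost_all_CS SA SB (PSC SF)) \<and>
    \<not> (for_almost_all_CS SA SB (PTC SF) \<and> for_almost_all_CS SA SB (PSC SF))"
proof
  let ?S = "SA @\<^sub>c SB"
  let ?I = "star_positions ?S"
  have AE_gen: "AE t in parameter_measure ?S. generic ?I t"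
    unfolding parameter_measure_def by (rule AE_generic[OF finite_star_positions])
  have CS: "A \<in> carrier_mat n n" "B \<in> carrier_mat n m" "A @\<^sub>c B \<in> realizations ?S" "controllable A B"
    if "(A, B) \<in> CS SA SB" for A B
    using that assms(1,2) by (auto simp: CS_def)
  show "for_almost_all_CS SA SB (PTC SF) \<or> for_almost_all_CS SA SB (PSC SF)"
  proof (cases "\<exists>(A, B)\<in>CS SA SB. generic ?I (parameters ?S (A @\<^sub>c B)) \<and> \<not> PTC SF A B")
    case True
    then obtain A B where AB: "(A, B) \<in> CS SA SB" "generic ?I (parameters ?S (A @\<^sub>c B))" "\<not> PTC SF A B"
      by blast
    have "PSC SF A' B'" if "(A', B') \<in> CS SA SB" "generic ?I (parameters ?S (A' @\<^sub>c B'))" for A' B'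
      using generic_not_PTC_invariant[OF CS(1-3)[OF AB(1)] CS(1-3)[OF that(1)] AB(2) that(2) AB(3)]
        CS(4)[OF that(1)] by (simp add: PSC_def)
    then have "for_almost_all_CS SA SB (PSC SF)"
      unfolding for_almost_all_CS_def using AE_gen by (auto elim!: eventually_mono)
    then show ?thesis ..
  next
    case False
    then have "for_almost_all_CS SA SB (PTC SF)"
      unfolding for_almost_all_CS_def using AE_gen by (auto elim!: eventually_mono)
    then show ?thesis ..
  qed
  show "\<not> (for_almost_all_CS SA SB (PTC SF) \<and> for_almost_all_CS SA SB (PSC SF))"
  proof
    assume both: "for_almost_all_CS SA SB (PTC SF) \<and> for_almost_all_CS SA SB (PSC SF)"
    have "AE t in parameter_measure ?S. \<forall>(A, B)\<in>CS SA SB. parameters ?S (A @\<^sub>c B) = t \<longrightarrow> PTC SF A B"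
      "AE t in parameter_measure ?S. \<forall>(A, B)\<in>CS SA SB. parameters ?S (A @\<^sub>c B) = t \<longrightarrow> PSC SF A B"
      using both[THEN conjunct1] both[THEN conjunct2] unfolding for_almost_all_CS_def by this
    then have "AE t in parameter_measure ?S. \<forall>(A, B)\<in>CS SA SB. parameters ?S (A @\<^sub>c B) \<noteq> t"
    proof eventually_elim
      case (elim t)
      show ?case
      proof clarify
        fix A B assume AB: "(A, B) \<in> CS SA SB" "t = parameters ?S (A @\<^sub>c B)"
        then have "PTC SF A B" "PSC SF A B" using elim by auto
        then show False by (simp add: PSC_def)
      qed
    qed
    then show False by (rule controllable_realizations_not_null[OF assms(1,2,4)])
  qed
qed

end
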